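(* Let $n\ge 2$ and $1\leq p \leq n-1$. Then the set of $\mathbf{x}\in\mathbb{R}^{(n, p)}$ which are projectively very well approximable has Lebesgue measure $0$ in $\mathbb{R}^{(n, p)}$.
   Context: $\mathcal{M}(n,\mathbb{Z})$ is the ring of $n\times n$ matrices with integer entries. $\mathbb{R}^{(n,p)}=\mathbb{R}^n\oplus\cdots\oplus\mathbb{R}^n$ ($p$ copies), i.e. $p$-tuples of column vectors in $\mathbb{R}^n$ (equivalently real $n\times p$ matrices), on which $n\times n$ matrices act by left multiplication. The norm $\|\cdot\|$ of a matrix is the maximum of the absolute values of its entries. The homogeneous exponent $h(\mathbf{x})$ of $\mathbf{x}\in\mathbb{R}^{(n,p)}$ is the infimum of all real $u$ for which there exists $c>0$ such that $\|\omega\mathbf{x}\|>c\|\omega\|^{-u}$ for all $\omega\in\mathcal{M}(n,\mathbb{Z})\setminus\{0\}$ (with $h(\mathbf{x})=+\infty$ if there is no such $u$). An element $\mathbf{x}\in\mathbb{R}^{(n,p)}$ is projectively very well approximable if $h(\mathbf{x})>(n-p)/p$. *)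

theory Defs
  imports "HOL-Analysis.Analysis"
begin

(* The space R^(n,p) is real^'p^'n: CARD('n) rows, CARD('p) columns. *)

definition max_norm :: "real^'p^'n \<Rightarrow> real" where
  "max_norm A = Max {\<bar>A $ i $ j\<bar> | i j. True}"

abbreviation real_mat :: "int^'p^'n \<Rightarrow> real^'p^'n" where
  "real_mat \<equiv> map_matrix real_of_int"

(* Extended-real infimum, so that Inf {} is infinity. *)
definition homogeneous_exponent :: "real^'p^'n \<Rightarrow> ereal" where
  "homogeneous_exponent x =
     Inf (ereal ` {u. \<exists>c>0. \<forall>\<omega> :: int^'n^'n. \<omega> \<noteq> 0 \<longrightarrow>
            max_norm (real_mat \<omega> ** x) > c * max_norm (real_mat \<omega>) powr (- u)})"

definition projectively_very_well_approximable :: "real^'p^'n \<Rightarrow> bool" where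
  "projectively_very_well_approximable x \<longleftrightarrow>
     homogeneous_exponent x > ereal ((real CARD('n) - real CARD('p)) / real CARD('p))"

end

theory Submission
  imports Defs
begin

text \<open>A nonzero integer matrix may be replaced by its row \<open>q\<close> of largest sup norm, so it suffices to
  bound \<open>q v* x\<close> from below for integer vectors \<open>q\<close>. On a fixed ball, the set where
  all entries of \<open>q v* x\<close> are at most \<open>\<epsilon>\<close> in absolute value has measure
  \<open>O((\<epsilon> / \<parallel>q\<parallel>) ^ p)\<close>. There are \<open>O(2 ^ (s * n))\<close> vectors \<open>q\<close> of norm about \<open>2 ^ s\<close>;
  with \<open>\<epsilon> = 2 powr (- u * s)\<close> the total measure is \<open>O(2 powr (s * (n - (u + 1) * p)))\<close>, which is
  summable over \<open>s\<close> exactly when \<open>u > (n - p) / p\<close>. By Borel-Cantelli, for almost all \<open>x\<close>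
  only finitely many \<open>q\<close> violate the bound, and these only affect the constant because
  \<open>q v* x \<noteq> 0\<close> almost everywhere.\<close>

section \<open>Measure of the set where \<open>q v* x\<close> is small\<close>

definition slab :: "real^'n \<Rightarrow> real \<Rightarrow> real \<Rightarrow> (real^'p^'n) set" where
  "slab q R \<epsilon> = {x \<in> cball 0 R. \<forall>j. \<bar>(q v* x) $ j\<bar> \<le> \<epsilon>}"

lemma vector_matrix_mult_axis:
  fixes q :: "real^'n"
  shows "q v* axis k v = q $ k *\<^sub>R v"
  by (simp add: vec_eq_iff vector_matrix_mult_def axis_def if_distrib if_distribR cong: if_cong)

lemma lmeasurable_slab:
  fixes q :: "real^'n"
  shows "(slab q R \<epsilon> :: (real^'p^'n) set) \<in> lmeasurable"
proof -
  have "closed {x :: real^'p^'n. \<forall>j. \<bar>(q v* x) $ j\<bar> \<le> \<epsilon>}"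
    unfolding vector_matrix_mult_def vec_lambda_beta
    by (intro closed_Collect_all closed_Collect_le continuous_intros)
  moreover have "slab q R \<epsilon> = cball 0 R \<inter> {x :: real^'p^'n. \<forall>j. \<bar>(q v* x) $ j\<bar> \<le> \<epsilon>}"
    by (auto simp: slab_def)
  ultimately show ?thesis
    by (simp add: compact_Int_closed lmeasurable_compact)
qed

text \<open>Translating row \<open>k\<close> by the points of a grid of mesh \<open>3 * \<epsilon> / \<bar>q $ k\<bar>\<close> inside the unit cube
  moves the slab to pairwise disjoint sets of equal measure, all contained in one ball.\<close>

lemma measure_slab_le:
  fixes q :: "real^'n"
  assumes k: "q $ k \<noteq> 0" and \<epsilon>: "0 < \<epsilon>"
  shows "measure lebesgue (slab q R \<epsilon> :: (real^'p^'n) set)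
    \<le> measure lebesgue (cball 0 (R + real CARD('p)) :: (real^'p^'n) set) * (3 * \<epsilon> / \<bar>q $ k\<bar>) ^ CARD('p)"
proof -
  define d where "d = 3 * \<epsilon> / \<bar>q $ k\<bar>"
  have d: "0 < d" using k \<epsilon> by (simp add: d_def)
  have dq: "d * \<bar>q $ k\<bar> = 3 * \<epsilon>" using k by (simp add: d_def)
  \<comment> \<open>\<open>M\<close> counts the multiples of \<open>d\<close> in [0, 1): at least 1
    / \<open>d\<close> of them, and each is below 1. For \<open>d\<close> > 1 only 0 remains and
    \<open>M\<close> = 1, so large \<open>\<epsilon>\<close> needs no separate case.\<close>
  define M where "M = nat \<lceil>1 / d\<rceil>"
  have M: "1 / d \<le> real M" "\<And>m. m < M \<Longrightarrow> real m < 1 / d"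
    by (auto simp: M_def real_nat_ceiling_ge less_ceiling_iff zless_nat_eq_int_zless)
  define I where "I = (PiE UNIV (\<lambda>_. {..<M}) :: ('p \<Rightarrow> nat) set)"
  have finI: "finite I" unfolding I_def by (intro finite_PiE) auto
  have cardI: "card I = M ^ CARD('p)" unfolding I_def by (simp add: card_PiE)
  \<comment> \<open>Only row \<open>k\<close> is nonzero, so translating by \<open>t m\<close> adds
    exactly \<open>q $ k\<close> times the grid point to \<open>q v* x\<close>.\<close>
  define t :: "('p \<Rightarrow> nat) \<Rightarrow> real^'p^'n" where "t m = axis k (\<chi> j. d * real (m j))" for m
  define S where "S = (slab q R \<epsilon> :: (real^'p^'n) set)"
  have Sm: "S \<in> lmeasurable" by (simp add: S_def lmeasurable_slab)
  have meas: "(+) (t m) ` S \<in> lmeasurable" for m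
    by (rule measurable_translation[OF Sm])
  \<comment> \<open>The l1 norm bounds the Euclidean norm, and each of the \<open>CARD('p)\<close>
    coordinates is at most 1; this is the amount by which the radius of the ball has to
    grow.\<close>
  have tn: "norm (t m) \<le> real CARD('p)" if "m \<in> I" for m
  proof -
    have "norm (t m) \<le> (\<Sum>j\<in>UNIV. \<bar>d * real (m j)\<bar>)"
      using norm_le_l1_cart[of "\<chi> j. d * real (m j)"] by (simp add: t_def norm_eq_sqrt_inner[of "axis k _"] norm_eq_sqrt_inner[of "vec_lambda _"] inner_axis')
    also have "\<dots> \<le> (\<Sum>j\<in>(UNIV::'p set). 1)"
    proof (rule sum_mono)
      fix j :: 'p
      have "m j < M" using that by (auto simp: I_def)
      then have "real (m j) < 1 / d" by (rule M)
      then show "\<bar>d * real (m j)\<bar> \<le> 1" using d by (simp add: field_simps)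
    qed
    finally show ?thesis by simp
  qed
  \<comment> \<open>Grid points that differ in coordinate \<open>j\<close> shift entry
    \<open>j\<close> of \<open>q v* x\<close> by amounts at least 3 * \<open>\<epsilon>\<close>
    apart, while over \<open>S\<close> this entry varies by at most 2 * \<open>\<epsilon>\<close>.
    The factor 3 leaves room for disjointness although the slabs are closed.\<close>
  have disj: "pairwise (\<lambda>m m'. disjnt ((+) (t m) ` S) ((+) (t m') ` S)) I"
  proof (rule pairwiseI)
    fix m m' :: "'p \<Rightarrow> nat" assume "m \<noteq> m'"
    then obtain j where j: "m j \<noteq> m' j" by auto
    show "disjnt ((+) (t m) ` S) ((+) (t m') ` S)"
    proof (rule ccontr)
      assume "\<not> ?thesis"
      then obtain x y where xy: "x \<in> S" "y \<in> S" "t m + x = t m' + y"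
        by (auto simp: disjnt_iff)
      then have "(q v* (t m + x)) $ j = (q v* (t m' + y)) $ j" by simp
      then have "q $ k * (d * (real (m j) - real (m' j))) = (q v* y) $ j - (q v* x) $ j"
        by (simp add: t_def vector_matrix_mult_axis vector_matrix_mult_add_rdistrib algebra_simps)
      then have "\<bar>q $ k\<bar> * (d * \<bar>real (m j) - real (m' j)\<bar>) = \<bar>(q v* y) $ j - (q v* x) $ j\<bar>"
        using d by (metis abs_mult abs_of_pos)
      also have "\<dots> \<le> \<bar>(q v* y) $ j\<bar> + \<bar>(q v* x) $ j\<bar>" by simp
      also have "\<dots> \<le> 2 * \<epsilon>"
        using xy(1,2) add_mono[of "\<bar>(q v* y) $ j\<bar>" \<epsilon> "\<bar>(q v* x) $ j\<bar>" \<epsilon>] by (simp add: S_def slab_def)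
      finally have "(d * \<bar>q $ k\<bar>) * \<bar>real (m j) - real (m' j)\<bar> \<le> 2 * \<epsilon>"
        by (simp add: mult_ac)
      moreover have "1 \<le> \<bar>real (m j) - real (m' j)\<bar>" using j by linarith
      ultimately show False
        using \<epsilon> mult_left_mono[of 1 "\<bar>real (m j) - real (m' j)\<bar>" "3 * \<epsilon>"] unfolding dq by linarith
    qed
  qed
  have "real M ^ CARD('p) * measure lebesgue S = (\<Sum>m\<in>I. measure lebesgue ((+) (t m) ` S))"
    by (simp add: measure_translation cardI)
  also have "\<dots> = measure lebesgue (\<Union>m\<in>I. (+) (t m) ` S)"
    using measure_UNION'[OF finI meas disj] by simp
  also have "\<dots> \<le> measure lebesgue (cball 0 (R + real CARD('p)) :: (real^'p^'n) set)" (is "_ \<le> ?K")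
  proof (rule measure_mono_fmeasurable)
    show "(\<Union>m\<in>I. (+) (t m) ` S) \<subseteq> cball 0 (R + real CARD('p))"
    proof clarify
      fix m x assume "m \<in> I" "x \<in> S"
      then show "t m + x \<in> cball 0 (R + real CARD('p))"
        using tn[of m] norm_triangle_ineq[of "t m" x] by (simp add: S_def slab_def)
    qed
    show "(\<Union>m\<in>I. (+) (t m) ` S) \<in> sets lebesgue"
      using finI meas by (intro sets.finite_UN) (auto dest: fmeasurableD)
    show "cball 0 (R + real CARD('p)) \<in> lmeasurable" by simp
  qed
  finally have *: "real M ^ CARD('p) * measure lebesgue S \<le> ?K" .
  have "(1 / d) ^ CARD('p) * measure lebesgue S \<le> real M ^ CARD('p) * measure lebesgue S"
    using M(1) d by (intro mult_right_mono power_mono) auto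
  then have "(1 / d) ^ CARD('p) * measure lebesgue S \<le> ?K" using * by linarith
  then have "measure lebesgue S \<le> ?K * d ^ CARD('p)"
    using d by (simp add: power_divide field_simps)
  then show ?thesis by (simp add: S_def d_def)
qed

section \<open>Integer vectors in dyadic shells and the Borel-Cantelli argument\<close>

lemma
  fixes N :: nat
  shows finite_integer_vectors_bounded: "finite {q :: int^'n. \<forall>i. \<bar>q $ i\<bar> \<le> int N}"
    and card_integer_vectors_bounded: "card {q :: int^'n. \<forall>i. \<bar>q $ i\<bar> \<le> int N} \<le> (2 * N + 1) ^ CARD('n)"
proof -
  define P where "P = (PiE UNIV (\<lambda>_. {- int N..int N}) :: ('n \<Rightarrow> int) set)"
  have sub: "{q :: int^'n. \<forall>i. \<bar>q $ i\<bar> \<le> int N} \<subseteq> vec_lambda ` P"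
  proof
    fix q :: "int^'n" assume "q \<in> {q. \<forall>i. \<bar>q $ i\<bar> \<le> int N}"
    then have "($) q \<in> P" by (auto simp: P_def abs_le_iff minus_le_iff)
    then show "q \<in> vec_lambda ` P" by (rule rev_image_eqI) simp
  qed
  have fin: "finite P" unfolding P_def by (intro finite_PiE) auto
  have "nat (2 * int N + 1) = 2 * N + 1" by linarith
  then have card: "card P = (2 * N + 1) ^ CARD('n)" by (simp add: P_def card_PiE)
  show "finite {q :: int^'n. \<forall>i. \<bar>q $ i\<bar> \<le> int N}"
    by (rule finite_subset[OF sub finite_imageI[OF fin]])
  have "card {q :: int^'n. \<forall>i. \<bar>q $ i\<bar> \<le> int N} \<le> card (vec_lambda ` P)"
    by (rule card_mono[OF finite_imageI[OF fin] sub])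
  also have "\<dots> \<le> card P" by (rule card_image_le[OF fin])
  finally show "card {q :: int^'n. \<forall>i. \<bar>q $ i\<bar> \<le> int N} \<le> (2 * N + 1) ^ CARD('n)"
    by (simp only: card)
qed

abbreviation real_vec :: "int^'n \<Rightarrow> real^'n" where
  "real_vec q \<equiv> (\<chi> i. real_of_int (q $ i))"

text \<open>The upper bound is not strict, so consecutive shells overlap; only covering matters, and
  counting a vector twice does no harm. Zero lies in no shell.\<close>

definition dyadic_shell :: "nat \<Rightarrow> (int^'n) set" where
  "dyadic_shell s = {q. (\<forall>i. \<bar>q $ i\<bar> \<le> 2 ^ Suc s) \<and> (\<exists>k. 2 ^ s \<le> \<bar>q $ k\<bar>)}"

lemma dyadic_shell_subset: "dyadic_shell s \<subseteq> {q. \<forall>i. \<bar>q $ i\<bar> \<le> int (2 ^ Suc s)}"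
  by (auto simp: dyadic_shell_def)

lemma finite_dyadic_shell: "finite (dyadic_shell s :: (int^'n) set)"
  by (rule finite_subset[OF dyadic_shell_subset finite_integer_vectors_bounded])

lemma card_dyadic_shell_le: "real (card (dyadic_shell s :: (int^'n) set)) \<le> (5 * 2 ^ s) ^ CARD('n)"
proof -
  have "card (dyadic_shell s :: (int^'n) set) \<le> (2 * 2 ^ Suc s + 1) ^ CARD('n)"
    by (rule order_trans[OF card_mono[OF finite_integer_vectors_bounded dyadic_shell_subset]
          card_integer_vectors_bounded])
  \<comment> \<open>The base is 4 * 2 ^ \<open>s\<close> + 1, and 1 is at most 2 ^
    \<open>s\<close>.\<close>
  also have "\<dots> \<le> (5 * 2 ^ s) ^ CARD('n)"
    by (intro power_mono) auto
  finally have "real (card (dyadic_shell s :: (int^'n) set)) \<le> real ((5 * 2 ^ s) ^ CARD('n))"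
    by (rule of_nat_mono)
  then show ?thesis by simp
qed

text \<open>All slabs of one shell are merged into a single event, so that Borel-Cantelli runs over
  \<open>s\<close> and the measures are dominated by a geometric series. The radius \<open>R\<close>
  is fixed to keep these measures finite.\<close>

lemma AE_eventually_notin_slabs:
  fixes R u :: real
  assumes u: "real CARD('n) < (u + 1) * real CARD('p)"
  shows "AE x :: real^'p^'n in lebesgue. \<forall>\<^sub>F s in sequentially.
    \<forall>q\<in>dyadic_shell s. x \<notin> slab (real_vec q) R (2 powr (- u * real s))"
proof -
  define A where "A s = (\<Union>q\<in>dyadic_shell s.
    slab (real_vec q) R (2 powr (- u * real s)) :: (real^'p^'n) set)" for s
  define K where "K = measure lebesgue (cball 0 (R + real CARD('p)) :: (real^'p^'n) set)"
  \<comment> \<open>About 2 ^ (\<open>s\<close> * n) vectors, each contributing on the order of (2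
    powr (- u * s) / 2 ^ s) ^ p, give the \<open>s\<close>-th power of this ratio. The hypothesis on
    \<open>u\<close> is \<open>u\<close> > (n - p) / p cleared of its denominator, and says that the
    ratio is below 1.\<close>
  define \<rho> where "\<rho> = 2 powr (real CARD('n) - (u + 1) * real CARD('p))"
  have K: "0 \<le> K" by (simp add: K_def)
  have \<rho>: "0 < \<rho>" "\<rho> < 1"
    using u powr_less_mono[of "real CARD('n) - (u + 1) * real CARD('p)" 0 2] by (auto simp: \<rho>_def)
  have Am: "A s \<in> lmeasurable" for s
    unfolding A_def by (intro fmeasurable.finite_UN finite_dyadic_shell lmeasurable_slab)
  have one: "measure lebesgue (slab (real_vec q) R (2 powr (- u * real s)) :: (real^'p^'n) set)
      \<le> K * (3 * 2 powr (- u * real s) / 2 ^ s) ^ CARD('p)"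
    if q: "q \<in> dyadic_shell s" for q :: "int^'n" and s
  proof -
    obtain k where "2 ^ s \<le> \<bar>q $ k\<bar>" using q by (auto simp: dyadic_shell_def)
    then have "real_of_int (2 ^ s) \<le> real_of_int \<bar>q $ k\<bar>" by (simp only: of_int_le_iff)
    then have k: "2 ^ s \<le> \<bar>real_of_int (q $ k)\<bar>" by simp
    have "0 < \<bar>real_of_int (q $ k)\<bar>" by (rule less_le_trans[OF _ k]) simp
    then have k0: "real_vec q $ k \<noteq> 0" by simp
    have "measure lebesgue (slab (real_vec q) R (2 powr (- u * real s)) :: (real^'p^'n) set)
        \<le> K * (3 * 2 powr (- u * real s) / \<bar>real_vec q $ k\<bar>) ^ CARD('p)"
      unfolding K_def by (rule measure_slab_le[OF k0]) simp
    also have "\<dots> \<le> K * (3 * 2 powr (- u * real s) / 2 ^ s) ^ CARD('p)"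
      using k k0 by (intro mult_left_mono power_mono divide_left_mono K) auto
    finally show ?thesis .
  qed
  have bound: "measure lebesgue (A s) \<le> (5 ^ CARD('n) * K * 3 ^ CARD('p)) * \<rho> ^ s" for s
  proof -
    have "measure lebesgue (A s) \<le> (\<Sum>q\<in>(dyadic_shell s :: (int^'n) set).
        measure lebesgue (slab (real_vec q) R (2 powr (- u * real s)) :: (real^'p^'n) set))"
      unfolding A_def
      by (intro measure_UNION_le finite_dyadic_shell fmeasurableD lmeasurable_slab)
    also have "\<dots> \<le> real (card (dyadic_shell s :: (int^'n) set)) *
        (K * (3 * 2 powr (- u * real s) / 2 ^ s) ^ CARD('p))"
      by (rule sum_bounded_above) (rule one)
    also have "\<dots> \<le> (5 * 2 ^ s) ^ CARD('n) * (K * (3 * 2 powr (- u * real s) / 2 ^ s) ^ CARD('p))"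
      by (intro mult_right_mono card_dyadic_shell_le mult_nonneg_nonneg K) simp
    also have "\<dots> = (5 ^ CARD('n) * K * 3 ^ CARD('p)) *
        ((2 ^ s) ^ CARD('n) * (2 powr (- u * real s) / 2 ^ s) ^ CARD('p))"
      by (simp add: power_mult_distrib power_divide)
    also have "(2 ^ s) ^ CARD('n) * (2 powr (- u * real s) / 2 ^ s) ^ CARD('p) = \<rho> ^ s"
    proof -
      have "(2 ^ s) ^ CARD('n) = (2::real) powr (real s * real CARD('n))"
        by (metis of_nat_mult power_mult powr_realpow zero_less_numeral)
      moreover have "2 powr (- u * real s) / 2 ^ s = 2 powr (- u * real s - real s)"
        by (simp only: powr_diff powr_realpow zero_less_numeral)
      moreover have "(2 powr (- u * real s - real s)) ^ CARD('p)
          = 2 powr ((- u * real s - real s) * real CARD('p))"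
        by (simp add: powr_powr flip: powr_realpow)
      moreover have "\<rho> ^ s = 2 powr ((real CARD('n) - (u + 1) * real CARD('p)) * real s)"
        unfolding \<rho>_def by (simp add: powr_powr flip: powr_realpow)
      moreover have "real s * real CARD('n) + (- u * real s - real s) * real CARD('p)
          = (real CARD('n) - (u + 1) * real CARD('p)) * real s"
        by (simp add: algebra_simps)
      ultimately show ?thesis by (simp only: powr_add[symmetric])
    qed
    finally show ?thesis .
  qed
  have "AE x in lebesgue. \<forall>\<^sub>F s in sequentially. x \<in> space lebesgue - A s"
  proof (rule borel_cantelli_AE1)
    show "A s \<in> sets lebesgue" for s using Am by (rule fmeasurableD)
    show "emeasure lebesgue (A s) < \<infinity>" for s using fmeasurableD2[OF Am[of s]] by (simp add: top.not_eq_extremum)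
    show "summable (\<lambda>s. measure lebesgue (A s))"
    proof (rule summable_comparison_test')
      show "summable (\<lambda>s. (5 ^ CARD('n) * K * 3 ^ CARD('p)) * \<rho> ^ s)"
        using \<rho> by (intro summable_mult summable_geometric) simp
      show "norm (measure lebesgue (A s)) \<le> (5 ^ CARD('n) * K * 3 ^ CARD('p)) * \<rho> ^ s" if "0 \<le> s" for s
        using bound[of s] by simp
    qed
  qed
  then show ?thesis by (simp add: A_def)
qed

section \<open>Lower bound for all integer vectors at once, for almost every
  \<open>x\<close>\<close>

lemma AE_vector_matrix_mult_nonzero:
  fixes q :: "real^'n"
  assumes "q \<noteq> 0"
  shows "AE x :: real^'p^'n in lebesgue. q v* x \<noteq> 0"
proof -
  obtain k where k: "q $ k \<noteq> 0" using assms by (auto simp: vec_eq_iff)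
  \<comment> \<open>One arbitrary column suffices: if \<open>q v* x\<close> vanishes, so does its
    entry \<open>j\<close>, and \<open>x\<close> lies in the hyperplane orthogonal to the matrix
    with \<open>q\<close> in column \<open>j\<close> and zeros elsewhere.\<close>
  fix j :: 'p
  define a :: "real^'p^'n" where "a = (\<chi> i. axis j (q $ i))"
  have "a \<noteq> 0" using k by (auto simp: a_def vec_eq_iff axis_def intro!: exI[of _ k] exI[of _ j])
  then have "{x. a \<bullet> x = 0} \<in> null_sets lebesgue"
    using negligible_hyperplane[of a 0] by (simp add: negligible_iff_null_sets)
  moreover have "a \<bullet> x = (q v* x) $ j" for x
    by (simp add: a_def inner_vec_def[of "\<chi> i. axis j (q $ i)"] inner_axis' vector_matrix_mult_def)
  ultimately show ?thesis
    by (auto intro!: AE_I'[of "{x. a \<bullet> x = 0}"])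
qed

definition sup_abs :: "int^'n \<Rightarrow> int" where
  "sup_abs q = Max (range (\<lambda>i. \<bar>q $ i\<bar>))"

lemma sup_abs_ge: "\<bar>q $ i\<bar> \<le> sup_abs q"
  by (simp add: sup_abs_def)

lemma sup_abs_attained: obtains k where "sup_abs q = \<bar>q $ k\<bar>"
proof -
  have "sup_abs q \<in> range (\<lambda>i. \<bar>q $ i\<bar>)" unfolding sup_abs_def by (rule Max_in) auto
  then show ?thesis using that by auto
qed

lemma sup_abs_ge_1:
  assumes "q \<noteq> 0"
  shows "1 \<le> sup_abs q"
proof -
  obtain k where "q $ k \<noteq> 0" using assms by (auto simp: vec_eq_iff)
  then show ?thesis using sup_abs_ge[of q k] by linarith
qed

lemma ex_dyadic_shell:
  assumes "q \<noteq> 0"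
  obtains s where "q \<in> dyadic_shell s" "2 ^ s \<le> sup_abs q" "sup_abs q < 2 ^ Suc s"
proof -
  obtain s where s: "2 ^ s \<le> nat (sup_abs q)" "nat (sup_abs q) < 2 ^ Suc s"
    using ex_power_ivl1[of 2 "nat (sup_abs q)"] sup_abs_ge_1[OF assms] unfolding Suc_eq_plus1 by force
  then have s: "2 ^ s \<le> sup_abs q" "sup_abs q < 2 ^ Suc s"
    using sup_abs_ge_1[OF assms] by (simp_all add: le_nat_iff nat_less_iff del: power_Suc)
  moreover have "q \<in> dyadic_shell s"
  proof -
    obtain k where "sup_abs q = \<bar>q $ k\<bar>" by (rule sup_abs_attained)
    moreover have "\<bar>q $ i\<bar> \<le> 2 ^ Suc s" for i using sup_abs_ge[of q i] s(2) by linarith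
    ultimately show ?thesis using s(1) by (auto simp: dyadic_shell_def)
  qed
  ultimately show ?thesis using that by blast
qed

text \<open>Far shells satisfy the bound with constant 1 by Borel-Cantelli; the finitely many other
  vectors only shrink the constant, since \<open>q v* x\<close> is nonzero for them. The sign of
  \<open>u\<close> makes \<open>powr (- u)\<close> decreasing, which permits passing from
  \<open>sup_abs q\<close> to 2 ^ \<open>s\<close> or to 1.\<close>

lemma AE_vector_matrix_mult_lower_bound:
  fixes u :: real
  assumes u: "real CARD('n) < (u + 1) * real CARD('p)" and u0: "0 \<le> u"
  shows "AE x :: real^'p^'n in lebesgue. \<exists>c>0. \<forall>q :: int^'n. q \<noteq> 0 \<longrightarrow>
    (\<exists>j. c * real_of_int (sup_abs q) powr (- u) < \<bar>(real_vec q v* x) $ j\<bar>)"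
proof -
  \<comment> \<open>Countably many radii cover the whole space, so one null set serves all of them;
    \<open>R\<close> is chosen later, depending on \<open>x\<close>.\<close>
  have "AE x :: real^'p^'n in lebesgue. \<forall>R::nat. \<forall>\<^sub>F s in sequentially.
      \<forall>q\<in>dyadic_shell s. x \<notin> slab (real_vec q) (real R) (2 powr (- u * real s))"
    unfolding AE_all_countable using AE_eventually_notin_slabs[OF u] by blast
  moreover have "AE x :: real^'p^'n in lebesgue. \<forall>q :: int^'n. q \<noteq> 0 \<longrightarrow> real_vec q v* x \<noteq> 0"
    unfolding AE_all_countable
  proof
    fix q :: "int^'n"
    show "AE x :: real^'p^'n in lebesgue. q \<noteq> 0 \<longrightarrow> real_vec q v* x \<noteq> 0"
    proof (cases "q = 0")
      case False
      then have "real_vec q \<noteq> 0" by (auto simp: vec_eq_iff)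
      then show ?thesis using AE_vector_matrix_mult_nonzero by auto
    qed simp
  qed
  ultimately show ?thesis
  proof eventually_elim
    fix x :: "real^'p^'n"
    assume ev: "\<forall>R::nat. \<forall>\<^sub>F s in sequentially.
      \<forall>q\<in>dyadic_shell s. x \<notin> slab (real_vec q) (real R) (2 powr (- u * real s))"
    assume nz: "\<forall>q :: int^'n. q \<noteq> 0 \<longrightarrow> real_vec q v* x \<noteq> 0"
    obtain R :: nat where R: "norm x \<le> real R" using real_arch_simple by blast
    obtain s0 where s0: "\<And>s q. s0 \<le> s \<Longrightarrow> q \<in> dyadic_shell s \<Longrightarrow>
        x \<notin> slab (real_vec q) (real R) (2 powr (- u * real s))"
      using ev unfolding eventually_sequentially by meson
    \<comment> \<open>This contains every nonzero vector from a shell with \<open>s\<close> <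
      \<open>s0\<close>, because there \<open>sup_abs q\<close> < 2 ^ \<open>Suc s\<close> \<le> 2 ^
      \<open>s0\<close>.\<close>
    define F where "F = {q :: int^'n. q \<noteq> 0 \<and> (\<forall>i. \<bar>q $ i\<bar> \<le> int (2 ^ s0))}"
    have finF: "finite F"
      unfolding F_def by (rule finite_subset[OF _ finite_integer_vectors_bounded[of "2 ^ s0"]]) auto
    \<comment> \<open>The element 1 keeps \<open>c\<close> below the constant that works from
      \<open>s0\<close> on; halving makes the inequality strict on \<open>F\<close>.\<close>
    define c where "c = Min (insert 1 ((\<lambda>q. infnorm (real_vec q v* x)) ` F)) / 2"
    have c0: "0 < c"
      using finF nz by (auto simp: c_def F_def infnorm_pos_lt)
    have "Min (insert 1 ((\<lambda>q. infnorm (real_vec q v* x)) ` F)) \<le> 1"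
      using finF by (intro Min_le) auto
    then have c1: "c < 1" by (simp add: c_def)
    have cF: "c < infnorm (real_vec q v* x)" if "q \<in> F" for q
    proof -
      have "2 * c \<le> infnorm (real_vec q v* x)"
        using finF that unfolding c_def by (simp del: Min_insert)
      then show ?thesis using c0 by linarith
    qed
    have "\<exists>j. c * real_of_int (sup_abs q) powr (- u) < \<bar>(real_vec q v* x) $ j\<bar>"
      if q: "q \<noteq> 0" for q :: "int^'n"
    proof -
      obtain s where s: "q \<in> dyadic_shell s" "2 ^ s \<le> sup_abs q" "sup_abs q < 2 ^ Suc s"
        using ex_dyadic_shell[OF q] .
      show ?thesis
      proof (cases "s0 \<le> s")
        case True
        then obtain j where j: "2 powr (- u * real s) < \<bar>(real_vec q v* x) $ j\<bar>"
          using s0[OF True s(1)] R by (auto simp: slab_def not_le)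
        have "real_of_int (2 ^ s) \<le> real_of_int (sup_abs q)" using s(2) by (simp only: of_int_le_iff)
        then have "2 powr real s \<le> real_of_int (sup_abs q)" by (simp add: powr_realpow)
        then have "real_of_int (sup_abs q) powr (- u) \<le> (2 powr real s) powr (- u)"
          using u0 by (intro powr_mono2') auto
        also have "\<dots> = 2 powr (- u * real s)" by (simp add: powr_powr mult.commute)
        finally have "c * real_of_int (sup_abs q) powr (- u) \<le> 1 * 2 powr (- u * real s)"
          using c0 c1 by (intro mult_mono) auto
        then show ?thesis using j by (intro exI[of _ j]) linarith
      next
        case False
        have "sup_abs q \<le> 2 ^ s0"
          using s(3) power_increasing[of "Suc s" s0 "2::int"] False by simp
        then have "q \<in> F" using q sup_abs_ge[of q] by (auto simp: F_def intro: order_trans)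
        then have c: "c < infnorm (real_vec q v* x)" by (rule cF)
        have "\<exists>j. \<not> \<bar>(real_vec q v* x) $ j\<bar> \<le> c"
        proof (rule ccontr)
          assume "\<not> ?thesis"
          then have "infnorm (real_vec q v* x) \<le> c" unfolding infnorm_cart by (intro cSup_least) auto
          then show False using c by simp
        qed
        then obtain j where j: "c < \<bar>(real_vec q v* x) $ j\<bar>" by (auto simp: not_le)
        have "real_of_int (sup_abs q) powr (- u) \<le> 1 powr (- u)"
          using sup_abs_ge_1[OF q] u0 by (intro powr_mono2') auto
        then have "c * real_of_int (sup_abs q) powr (- u) \<le> c * 1"
          using c0 by (intro mult_left_mono) auto
        then show ?thesis using j by (intro exI[of _ j]) linarith
      qed
    qed
    then show "\<exists>c>0. \<forall>q :: int^'n. q \<noteq> 0 \<longrightarrow>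
      (\<exists>j. c * real_of_int (sup_abs q) powr (- u) < \<bar>(real_vec q v* x) $ j\<bar>)"
      using c0 by blast
  qed
qed

section \<open>From integer vectors to integer matrices and the exponent\<close>

lemma max_norm_eq: "max_norm A = Max (range (\<lambda>(i, j). \<bar>A $ i $ j\<bar>))"
  unfolding max_norm_def by (rule arg_cong[of _ _ Max]) force

lemma max_norm_ge: "\<bar>A $ i $ j\<bar> \<le> max_norm A"
  unfolding max_norm_eq by (intro Max_ge) auto

lemma max_norm_attained: obtains i j where "max_norm A = \<bar>A $ i $ j\<bar>"
proof -
  have "max_norm A \<in> range (\<lambda>(i, j). \<bar>A $ i $ j\<bar>)"
    unfolding max_norm_eq by (rule Max_in) auto
  then show ?thesis using that by auto
qed

text \<open>The row of \<open>\<omega>\<close> through an entry of largest absolute value is nonzero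
  and has sup norm \<open>max_norm (real_mat \<omega>)\<close>, and its product with
  \<open>x\<close> is a row of the full product. Hence \<open>c\<close> carries over unchanged and
  \<open>u\<close> belongs to the set whose infimum is taken.\<close>

lemma homogeneous_exponent_le:
  fixes x :: "real^'p^'n"
  assumes c: "0 < c"
    and rows: "\<And>q :: int^'n. q \<noteq> 0 \<Longrightarrow>
      \<exists>j. c * real_of_int (sup_abs q) powr (- u) < \<bar>(real_vec q v* x) $ j\<bar>"
  shows "homogeneous_exponent x \<le> ereal u"
proof -
  have "c * max_norm (real_mat \<omega>) powr (- u) < max_norm (real_mat \<omega> ** x)" if "\<omega> \<noteq> 0" for \<omega> :: "int^'n^'n"
  proof -
    obtain i k where ik: "max_norm (real_mat \<omega>) = \<bar>real_mat \<omega> $ i $ k\<bar>" by (rule max_norm_attained)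
    have le: "\<bar>\<omega> $ i' $ k'\<bar> \<le> \<bar>\<omega> $ i $ k\<bar>" for i' k'
      using max_norm_ge[of "real_mat \<omega>" i' k'] unfolding ik by (simp add: map_matrix_def)
    have "\<omega> $ i \<noteq> 0"
    proof
      assume "\<omega> $ i = 0"
      then have "\<omega> = 0" using le by (simp add: vec_eq_iff)
      then show False using that by simp
    qed
    then obtain j where j: "c * real_of_int (sup_abs (\<omega> $ i)) powr (- u) < \<bar>(real_vec (\<omega> $ i) v* x) $ j\<bar>"
      using rows by blast
    have "sup_abs (\<omega> $ i) = \<bar>\<omega> $ i $ k\<bar>"
      using le sup_abs_attained[of "\<omega> $ i"] sup_abs_ge[of "\<omega> $ i" k] by (metis order_antisym)
    then have "real_of_int (sup_abs (\<omega> $ i)) = max_norm (real_mat \<omega>)"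
      unfolding ik by (simp add: map_matrix_def)
    moreover have "(real_vec (\<omega> $ i) v* x) $ j = (real_mat \<omega> ** x) $ i $ j"
      by (simp add: vector_matrix_mult_def matrix_matrix_mult_def map_matrix_def)
    ultimately show ?thesis
      using j max_norm_ge[of "real_mat \<omega> ** x" i j] by simp
  qed
  then show ?thesis
    unfolding homogeneous_exponent_def using c by (intro Inf_lower imageI) auto
qed

theorem proposition4p2:
  assumes "2 \<le> CARD('n::finite)"
    and "1 \<le> CARD('p::finite)"
    and "CARD('p) \<le> CARD('n) - 1"
  shows "{x :: real^'p^'n. projectively_very_well_approximable x} \<in> null_sets lebesgue"
proof -
  define w where "w = (real CARD('n) - real CARD('p)) / real CARD('p)"
  have w0: "0 \<le> w" using assms by (simp add: w_def)
  have w1: "(w + 1) * real CARD('p) = real CARD('n)" by (simp add: w_def field_simps)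
  \<comment> \<open>The lower bound needs an exponent strictly above the critical value
    \<open>w\<close>, so it is applied along a sequence decreasing to \<open>w\<close>; the
    exceptional sets are countably many, and the limit gives the bound \<open>w\<close>
    itself.\<close>
  have "AE x :: real^'p^'n in lebesgue. \<forall>m::nat. homogeneous_exponent x \<le> ereal (w + 1 / real (Suc m))"
    unfolding AE_all_countable
  proof
    fix m :: nat
    have "(w + 1) * real CARD('p) < (w + 1 / real (Suc m) + 1) * real CARD('p)"
      by (intro mult_strict_right_mono) auto
    then have "AE x :: real^'p^'n in lebesgue. \<exists>c>0. \<forall>q :: int^'n. q \<noteq> 0 \<longrightarrow>
        (\<exists>j. c * real_of_int (sup_abs q) powr (- (w + 1 / real (Suc m))) < \<bar>(real_vec q v* x) $ j\<bar>)"
      using w0 w1 by (intro AE_vector_matrix_mult_lower_bound) auto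
    then show "AE x :: real^'p^'n in lebesgue. homogeneous_exponent x \<le> ereal (w + 1 / real (Suc m))"
      by (rule eventually_mono) (metis homogeneous_exponent_le)
  qed
  then have "AE x :: real^'p^'n in lebesgue. \<not> projectively_very_well_approximable x"
  proof eventually_elim
    fix x :: "real^'p^'n"
    assume *: "\<forall>m::nat. homogeneous_exponent x \<le> ereal (w + 1 / real (Suc m))"
    have "(\<lambda>m. w + 1 / real (Suc m)) \<longlonglongrightarrow> w + 0"
      by (intro tendsto_intros LIMSEQ_Suc[OF lim_1_over_n])
    then have "(\<lambda>m. ereal (w + 1 / real (Suc m))) \<longlonglongrightarrow> ereal w" by simp
    then have "homogeneous_exponent x \<le> ereal w"
      by (rule LIMSEQ_le_const) (use * in auto)
    then show "\<not> projectively_very_well_approximable x"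
      by (simp add: projectively_very_well_approximable_def w_def not_less)
  qed
  \<comment> \<open>The almost-everywhere statement only yields a null set covering the exceptional
    points; completeness of Lebesgue measure makes the exceptional set itself measurable and
    null.\<close>
  then obtain N where "N \<in> null_sets lebesgue" "{x :: real^'p^'n. projectively_very_well_approximable x} \<subseteq> N"
    by (auto simp: eventually_ae_filter)
  then show ?thesis
    by (meson negligible_iff_null_sets negligible_subset)
qed

end
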